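(* Let $H\in(0,1)$, let $n\ge1$ be an integer, and let $B^1_H,\dots,B^n_H$ be independent fractional Brownian motions with Hurst parameter $H$. For the process $$J^{n-1}_F(t)=B^1_H\left(|B^2_H(\ldots|B^n_H(t)|^{1/H}\ldots)|^{1/H}\right),\qquad t>0,$$ the following equalities in distribution hold for every $t>0$: $$J^{n-1}_F(t)\stackrel{i.d.}{=}B^1\left(|B^2(\ldots|B^n_H(t)|^2\ldots)|^2\right)\stackrel{i.d.}{=}\prod_{i=1}^nB^i_{\frac Hn}(t),$$ where in the second expression $B^1,B^2,\dots$ (all processes except the innermost one, $B^n_H$) are standard Brownian motions, independent of each other and of $B^n_H$, and in the third expression $B^1_{H/n},\dots,B^n_{H/n}$ are independent fractional Brownian motions with Hurst parameter $H/n$.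
   Context: A fractional Brownian motion $B_H$ with Hurst parameter $H\in(0,1)$ is a centred Gaussian process with covariance $E\{B_H(s)B_H(t)\}=\frac12\left(|t|^{2H}+|s|^{2H}-|t-s|^{2H}\right)$. $X(t)\stackrel{i.d.}{=}Y(t)$ means that, for each fixed $t$, the random variables $X(t)$ and $Y(t)$ have the same law (equality of one-dimensional distributions). For $n=1$ the first two expressions are both $B^1_H(t)$; for $n=2$ they are $B^1_H(|B^2_H(t)|^{1/H})$ and $B^1(|B^2_H(t)|^2)$.
   Formalization: The fractional Brownian motions are taken with continuous sample paths (every path continuous on t≥0); with only the Gaussian and covariance conditions the claim can fail, since the outer process may be altered at the random inner time without changing its law. *)

theory Defs
  imports "HOL-Probability.Probability"
begin

text \<open>A process indexed by \<open>[0, \<infinity>)\<close> is a function \<open>X :: real \<Rightarrow> 'a \<Rightarrow> real\<close> (time, then sample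
  point); its values at negative times are ignored.\<close>

text \<open>Constants count as (degenerate) Gaussian variables; they occur in every process that
  vanishes at time 0.\<close>

definition gaussian_rv :: "'a measure \<Rightarrow> ('a \<Rightarrow> real) \<Rightarrow> bool" where
  "gaussian_rv M X \<longleftrightarrow> X \<in> borel_measurable M \<and>
     ((\<exists>\<mu>. AE \<omega> in M. X \<omega> = \<mu>) \<or>
      (\<exists>\<mu> \<sigma>. 0 < \<sigma> \<and> distributed M lborel X (normal_density \<mu> \<sigma>)))"

definition gaussian_process :: "'a measure \<Rightarrow> (real \<Rightarrow> 'a \<Rightarrow> real) \<Rightarrow> bool" where
  "gaussian_process M X \<longleftrightarrow>
     (\<forall>T c. finite T \<and> T \<subseteq> {0..} \<longrightarrow> gaussian_rv M (\<lambda>\<omega>. \<Sum>t\<in>T. c t * X t \<omega>))"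

text \<open>Continuity of the sample paths is part of both definitions below. Without such a regularity
  condition a process evaluated at an independent random time need not be measurable, and its law
  is not determined by the finite-dimensional distributions.\<close>

definition fractional_brownian_motion ::
    "'a measure \<Rightarrow> real \<Rightarrow> (real \<Rightarrow> 'a \<Rightarrow> real) \<Rightarrow> bool" where
  "fractional_brownian_motion M H B \<longleftrightarrow>
     gaussian_process M B \<and>
     (\<forall>t\<ge>0. prob_space.expectation M (B t) = 0) \<and>
     (\<forall>s\<ge>0. \<forall>t\<ge>0. prob_space.expectation M (\<lambda>\<omega>. B s \<omega> * B t \<omega>) =
        1/2 * (\<bar>t\<bar> powr (2 * H) + \<bar>s\<bar> powr (2 * H) - \<bar>t - s\<bar> powr (2 * H))) \<and>
     (\<forall>\<omega>\<in>space M. continuous_on {0..} (\<lambda>t. B t \<omega>))"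

definition standard_brownian_motion :: "'a measure \<Rightarrow> (real \<Rightarrow> 'a \<Rightarrow> real) \<Rightarrow> bool" where
  "standard_brownian_motion M B \<longleftrightarrow>
     (\<forall>t\<ge>0. B t \<in> borel_measurable M) \<and>
     (AE \<omega> in M. B 0 \<omega> = 0) \<and>
     (\<forall>s t. 0 \<le> s \<and> s < t \<longrightarrow>
        distributed M lborel (\<lambda>\<omega>. B t \<omega> - B s \<omega>) (normal_density 0 (sqrt (t - s)))) \<and>
     (\<forall>(k::nat) \<tau>. 0 \<le> \<tau> 0 \<and> (\<forall>i<k. \<tau> i < \<tau> (Suc i)) \<longrightarrow>
        prob_space.indep_vars M (\<lambda>_. borel) (\<lambda>i \<omega>. B (\<tau> (Suc i)) \<omega> - B (\<tau> i) \<omega>) {..<k}) \<and>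
     (\<forall>\<omega>\<in>space M. continuous_on {0..} (\<lambda>t. B t \<omega>))"

text \<open>Independence of whole processes, viewed as random elements of the product space
  \<open>\<real>\<^bsup>[0,\<infinity>)\<^esup>\<close>.\<close>

definition indep_processes :: "'a measure \<Rightarrow> 'i set \<Rightarrow> ('i \<Rightarrow> real \<Rightarrow> 'a \<Rightarrow> real) \<Rightarrow> bool" where
  "indep_processes M I B \<longleftrightarrow>
     prob_space.indep_vars M (\<lambda>_. \<Pi>\<^sub>M t\<in>{0::real..}. borel) (\<lambda>i \<omega>. \<lambda>t\<in>{0..}. B i t \<omega>) I"

text \<open>\<open>iterated_process g B m t = B 1 (g (B 2 (g \<dots> (g (B (m + 1) t)))))\<close>, with \<open>m\<close>
  compositions of the \<open>m + 1\<close> processes \<open>B 1, \<dots>, B (m + 1)\<close>, the last being the innermost.\<close>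

primrec iterated_process ::
    "(real \<Rightarrow> real) \<Rightarrow> (nat \<Rightarrow> real \<Rightarrow> 'a \<Rightarrow> real) \<Rightarrow> nat \<Rightarrow> real \<Rightarrow> 'a \<Rightarrow> real" where
  "iterated_process g B 0 t \<omega> = B 1 t \<omega>"
| "iterated_process g B (Suc m) t \<omega> = iterated_process g B m (g (B (m + 2) t \<omega>)) \<omega>"

text \<open>Measurability is included because \<open>distr\<close> is meaningful only for measurable maps.\<close>

definition same_law :: "'a measure \<Rightarrow> ('a \<Rightarrow> real) \<Rightarrow> 'b measure \<Rightarrow> ('b \<Rightarrow> real) \<Rightarrow> bool" where
  "same_law M X N Y \<longleftrightarrow> X \<in> borel_measurable M \<and> Y \<in> borel_measurable N \<and>
     distr M borel X = distr N borel Y"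

end

theory Submission
  imports Defs
begin

text \<open>If \<open>X\<close> is a continuous process independent of \<open>Y\<close> and \<open>X (g y)\<close> is distributed as
  \<open>y Z\<close> with \<open>Z\<close> standard normal, for every real \<open>y\<close>, then conditioning on \<open>Y\<close> shows that
  \<open>X (g Y)\<close> is distributed as \<open>Z Y\<close> with \<open>Z\<close> independent of \<open>Y\<close>. Fractional Brownian motion has
  this property for \<open>g y = \<bar>y\<bar> powr (1 / H)\<close>, and Brownian motion for \<open>g y = \<bar>y\<bar>\<^sup>2\<close>. Peeling off one
  process at a time, both iterated processes at time \<open>t\<close> are distributed as \<open>t powr H\<close> times a
  product of \<open>n\<close> independent standard normal variables, and so is the product of the \<open>n\<close> fractional
  Brownian motions with parameter \<open>H / n\<close>.\<close>

section \<open>Evaluation of continuous paths at random times\<close>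

text \<open>Evaluation \<open>(x, s) \<mapsto> x s\<close> is not measurable on the product space. Approximating \<open>s\<close> by
  multiples of \<open>1 / (k + 1)\<close> gives a measurable map that agrees with it on continuous paths.\<close>

definition path_eval :: "(real \<Rightarrow> real) \<Rightarrow> real \<Rightarrow> real" where
  "path_eval x s = lim (\<lambda>k. x (real (nat \<lfloor>s * real (Suc k)\<rfloor>) / real (Suc k)))"

text \<open>For each \<open>k\<close> the grid point takes only countably many values, and at a
  fixed grid point the map is a coordinate projection; measurability then passes to the limit. The
  \<open>nat\<close> sends negative times to \<open>0\<close>, so every coordinate used lies in the
  index set.\<close>

lemma path_eval_measurable:
  "(\<lambda>(x, s). path_eval x s) \<in> borel_measurable ((\<Pi>\<^sub>M t\<in>{0::real..}. borel) \<Otimes>\<^sub>M borel)"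
proof -
  let ?S = "(\<Pi>\<^sub>M t\<in>{0::real..}. (borel :: real measure)) \<Otimes>\<^sub>M (borel :: real measure)"
  have "(\<lambda>p. fst p (real (nat \<lfloor>snd p * real (Suc k)\<rfloor>) / real (Suc k))) \<in> borel_measurable ?S" for k
  proof (rule measurable_compose_countable
      [where f = "\<lambda>j p. fst p (real j / real (Suc k))" and g = "\<lambda>p. nat \<lfloor>snd p * real (Suc k)\<rfloor>"])
    show "(\<lambda>p. fst p (real j / real (Suc k))) \<in> borel_measurable ?S" for j
      by (rule measurable_compose[OF measurable_fst measurable_component_singleton]) simp
  qed measurable
  then show ?thesis
    unfolding path_eval_def split_beta by (rule borel_measurable_lim_metric)
qed

lemma continuous_on_restrict_iff:
  "continuous_on S (restrict f S) \<longleftrightarrow> continuous_on S f"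
  by (rule continuous_on_cong) auto

text \<open>The grid points stay in \<open>{0..}\<close> and are squeezed between
  \<open>s - 1 / real (Suc k)\<close> and \<open>s\<close>, so continuity of the path gives the
  limit.\<close>

lemma path_eval_eq:
  assumes "continuous_on {0..} x" "0 \<le> s"
  shows "path_eval x s = x s"
proof -
  let ?a = "\<lambda>k. real (nat \<lfloor>s * real (Suc k)\<rfloor>) / real (Suc k)"
  have lo: "s - 1 / real (Suc k) \<le> ?a k" for k
  proof -
    have "s * real (Suc k) - 1 \<le> real (nat \<lfloor>s * real (Suc k)\<rfloor>)" by linarith
    from divide_right_mono[OF this, of "real (Suc k)"] show ?thesis
      by (simp add: diff_divide_distrib del: of_nat_Suc)
  qed
  have hi: "?a k \<le> s" for k
  proof -
    have "real (nat \<lfloor>s * real (Suc k)\<rfloor>) \<le> s * real (Suc k)" using assms(2) by simp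
    from divide_right_mono[OF this, of "real (Suc k)"] show ?thesis
      by (simp del: of_nat_Suc)
  qed
  have "(\<lambda>k. s - 1 / real (Suc k)) \<longlonglongrightarrow> s"
    using tendsto_diff[OF tendsto_const LIMSEQ_inverse_real_of_nat, of s]
    by (simp add: inverse_eq_divide)
  then have "?a \<longlonglongrightarrow> s"
    by (rule tendsto_sandwich[OF _ _ _ tendsto_const, rotated 2])
       (intro always_eventually allI lo hi)+
  then have "(\<lambda>k. x (?a k)) \<longlonglongrightarrow> x s"
    using assms by (intro continuous_on_tendsto_compose[where f = x and s = "{0..}"]) auto
  then show ?thesis
    unfolding path_eval_def by (rule limI)
qed

text \<open>The recursion defining \<open>iterated_process\<close> unfolds at the innermost process,
  whereas conditioning on the inner random time requires the outermost process to be
  isolated.\<close>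

lemma iterated_process_shift:
  "iterated_process g B (Suc m) t \<omega> =
     B 1 (g (iterated_process g (\<lambda>i. B (Suc i)) m t \<omega>)) \<omega>"
  by (induction m arbitrary: t) simp_all

text \<open>Joint measurability in sample point and time allows a measurable random time to be
  inserted. The starting time \<open>T\<close> is random because each unfolding turns the innermost
  value into the new starting time.\<close>

lemma iterated_process_measurable:
  assumes B: "\<And>i. i \<in> {1..Suc m} \<Longrightarrow> (\<lambda>(\<omega>, s). B i s \<omega>) \<in> borel_measurable (S \<Otimes>\<^sub>M borel)"
    and g: "g \<in> borel_measurable borel" and T: "T \<in> borel_measurable S"
  shows "(\<lambda>\<omega>. iterated_process g B m (T \<omega>) \<omega>) \<in> borel_measurable S"
  using B T
proof (induction m arbitrary: T)
  case 0
  have "(\<lambda>\<omega>. (\<omega>, T \<omega>)) \<in> S \<rightarrow>\<^sub>M S \<Otimes>\<^sub>M borel" using 0(2) by measurable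
  from measurable_compose[OF this 0(1)[of 1]] show ?case by simp
next
  case (Suc m)
  have "(\<lambda>\<omega>. (\<omega>, T \<omega>)) \<in> S \<rightarrow>\<^sub>M S \<Otimes>\<^sub>M borel" using Suc(3) by measurable
  from measurable_compose[OF measurable_compose[OF this Suc(2)[of "m + 2"]] g]
  have "(\<lambda>\<omega>. g (B (m + 2) (T \<omega>) \<omega>)) \<in> borel_measurable S" by simp
  then show ?case using Suc(1)[of "\<lambda>\<omega>. g (B (m + 2) (T \<omega>) \<omega>)"] Suc(2) by simp
qed

text \<open>This exhibits the iterated process as a functional of the restricted paths alone, so
  that independence of paths can be applied to it. Nonnegativity of \<open>g\<close> keeps all inner
  times where \<open>path_eval\<close> agrees with the path.\<close>

lemma iterated_process_path_eval:
  assumes "\<And>i. i \<in> {1..Suc m} \<Longrightarrow> continuous_on {0..} (\<lambda>s. B i s \<omega>)"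
    and "\<And>i. i \<in> {1..Suc m} \<Longrightarrow> x i = (\<lambda>s\<in>{0..}. B i s \<omega>)"
    and g: "\<And>y. 0 \<le> g y" and "0 \<le> t"
  shows "iterated_process g (\<lambda>i s x. path_eval (x i) s) m t x = iterated_process g B m t \<omega>"
proof -
  have *: "path_eval (x i) s = B i s \<omega>" if "i \<in> {1..Suc m}" "0 \<le> s" for i s
  proof -
    have "continuous_on {0..} (x i)"
      using assms(1)[OF that(1)] assms(2)[OF that(1)] by (simp only: continuous_on_restrict_iff)
    from path_eval_eq[OF this that(2)] assms(2)[OF that(1)] that(2) show ?thesis by simp
  qed
  show ?thesis
    using * assms(4) by (induction m arbitrary: t) (simp_all add: g)
qed

section \<open>Products of independent standard normal variables\<close>

abbreviation std_normal :: "real measure" where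
  "std_normal \<equiv> density lborel std_normal_density"

lemma prob_space_std_normal: "prob_space std_normal"
  by (rule prob_space_normal_density) simp

lemma sets_std_normal [measurable_cong]: "sets std_normal = sets borel"
  by simp

text \<open>Index convention: \<open>normal_product k\<close> has \<open>k + 1\<close> factors.\<close>

primrec normal_product :: "nat \<Rightarrow> real measure" where
  "normal_product 0 = std_normal"
| "normal_product (Suc k) = distr (std_normal \<Otimes>\<^sub>M normal_product k) borel (\<lambda>(z, y). z * y)"

lemma sets_normal_product [measurable_cong]: "sets (normal_product k) = sets borel"
  by (cases k) simp_all

lemma prob_space_normal_product: "prob_space (normal_product k)"
proof (induction k)
  case 0
  then show ?case by (simp add: prob_space_std_normal)
next
  case (Suc k)
  interpret A: prob_space std_normal by (rule prob_space_std_normal)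
  interpret B: prob_space "normal_product k" by (rule Suc)
  interpret pair_prob_space std_normal "normal_product k" ..
  show ?case by simp (rule prob_space_distr, measurable)
qed

text \<open>Scaling constants pull out of a product:
  \<open>(a * z) * (b * y) = (a * b) * (z * y)\<close>.\<close>

lemma distr_times_scaled_normal_product:
  "distr (distr std_normal borel ((*) a) \<Otimes>\<^sub>M distr (normal_product k) borel ((*) b)) borel
     (\<lambda>(z, y). z * y) = distr (normal_product (Suc k)) borel ((*) (a * b))"
proof -
  interpret D: prob_space "distr (normal_product k) borel ((*) b)"
    by (rule prob_space.prob_space_distr[OF prob_space_normal_product]) measurable
  have "distr std_normal borel ((*) a) \<Otimes>\<^sub>M distr (normal_product k) borel ((*) b) =
      distr (std_normal \<Otimes>\<^sub>M normal_product k) (borel \<Otimes>\<^sub>M borel) (\<lambda>(z, y). (a * z, b * y))"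
    by (rule pair_measure_distr) (measurable, rule D.sigma_finite_measure_axioms)
  then show ?thesis
    by (simp add: distr_distr comp_def split_beta algebra_simps)
qed

text \<open>Symmetry of the normal law. It permits a scaling factor \<open>y\<close> of either sign
  where the Gaussian variable only supplies the standard deviation
  \<open>\<bar>y\<bar>\<close>.\<close>

lemma distr_std_normal_uminus:
  "distr std_normal borel ((*) (- a)) = distr std_normal borel ((*) a)"
proof -
  interpret prob_space std_normal by (rule prob_space_std_normal)
  have "distributed std_normal lborel (\<lambda>x. x) std_normal_density"
    by (simp add: distributed_def distr_id2)
  from normal_density_affine[OF this, of "-1" 0]
  have "distr std_normal lborel uminus = std_normal"
    by (simp add: distributed_def)
  then have "distr std_normal borel ((*) a) = distr (distr std_normal lborel uminus) borel ((*) a)"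
    by simp
  also have "\<dots> = distr std_normal borel ((*) (- a))"
    by (subst distr_distr) (auto intro!: distr_cong)
  finally show ?thesis ..
qed

lemma distr_std_normal_abs:
  "distr std_normal borel ((*) \<bar>a\<bar>) = distr std_normal borel ((*) a)"
  by (cases "0 \<le> a") (simp_all add: distr_std_normal_uminus)

section \<open>One-dimensional laws of Gaussian processes\<close>

context prob_space
begin

text \<open>Centred Gaussian laws are written as scaled images of \<open>std_normal\<close> because
  this form also covers variance zero, where no density exists.\<close>

lemma distr_normal_density:
  assumes "distributed M lborel X (normal_density 0 \<sigma>)" "0 < \<sigma>"
  shows "distr M borel X = distr std_normal borel ((*) \<sigma>)"
proof -
  have "distributed M lborel (\<lambda>\<omega>. X \<omega> / \<sigma>) std_normal_density"
    using normal_standard_normal_convert[of \<sigma> X 0] assms by simp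
  then have X: "(\<lambda>\<omega>. X \<omega> / \<sigma>) \<in> borel_measurable M"
    and "distr M lborel (\<lambda>\<omega>. X \<omega> / \<sigma>) = std_normal"
    by (auto simp: distributed_def)
  then have "distr std_normal borel ((*) \<sigma>) = distr (distr M lborel (\<lambda>\<omega>. X \<omega> / \<sigma>)) borel ((*) \<sigma>)"
    by simp
  also have "\<dots> = distr M borel X"
    using X assms(2) by (subst distr_distr) (auto simp: comp_def)
  finally show ?thesis ..
qed

text \<open>Scaling factor \<open>0\<close> encodes the point mass at \<open>0\<close>, the law of
  both kinds of motion at time \<open>0\<close>.\<close>

lemma distr_AE_zero:
  assumes "X \<in> borel_measurable M" "AE \<omega> in M. X \<omega> = 0"
  shows "distr M borel X = distr std_normal borel ((*) 0)"
proof -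
  have "distr M borel X = distr M borel (\<lambda>_. 0)"
    using assms by (intro distr_cong_AE) auto
  also have "\<dots> = distr std_normal borel (\<lambda>_. 0 :: real)"
    by (simp add: prob_space.distr_const[OF prob_space_std_normal] distr_const)
  also have "\<dots> = distr std_normal borel ((*) 0)"
    by (rule distr_cong) simp_all
  finally show ?thesis .
qed

text \<open>Mean and second moment determine a Gaussian law. In the degenerate case the zero mean
  forces the constant to be \<open>0\<close>, hence \<open>v = 0\<close>; otherwise \<open>v\<close>
  is the standard deviation.\<close>

lemma distr_gaussian_rv:
  assumes "gaussian_rv M X" "expectation X = 0" "expectation (\<lambda>\<omega>. X \<omega> * X \<omega>) = v\<^sup>2" "0 \<le> v"
  shows "distr M borel X = distr std_normal borel ((*) v)"
proof -
  have X: "X \<in> borel_measurable M" using assms(1) by (simp add: gaussian_rv_def)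
  consider \<mu> where "AE \<omega> in M. X \<omega> = \<mu>"
    | \<mu> \<sigma> where "0 < \<sigma>" "distributed M lborel X (normal_density \<mu> \<sigma>)"
    using assms(1) unfolding gaussian_rv_def by blast
  then show ?thesis
  proof cases
    case 1
    have "expectation X = expectation (\<lambda>_. \<mu>)"
      using 1 X by (intro integral_cong_AE) auto
    then have AE0: "AE \<omega> in M. X \<omega> = 0" using 1 assms(2) by (simp add: prob_space)
    have "expectation (\<lambda>\<omega>. X \<omega> * X \<omega>) = expectation (\<lambda>_. 0)"
      using AE0 X by (intro integral_cong_AE) auto
    then have "v = 0" using assms(3) by simp
    then show ?thesis using distr_AE_zero[OF X AE0] by simp
  next
    case 2
    have "\<mu> = 0" using normal_distributed_expectation[OF 2] assms(2) by simp
    moreover have "\<sigma>\<^sup>2 = v\<^sup>2"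
      using normal_distributed_variance[OF 2] assms(2,3) by (simp add: power2_eq_square)
    then have "\<sigma> = v" using 2(1) assms(4) by simp
    ultimately show ?thesis using distr_normal_density 2 by simp
  qed
qed

lemma distr_fractional_brownian_motion:
  assumes "fractional_brownian_motion M H X" "0 \<le> t"
  shows "distr M borel (X t) = distr std_normal borel ((*) (t powr H))"
proof (rule distr_gaussian_rv)
  have "gaussian_rv M (\<lambda>\<omega>. \<Sum>s\<in>{t}. 1 * X s \<omega>)"
    using assms unfolding fractional_brownian_motion_def gaussian_process_def
    by (elim conjE allE[where x = "{t}"] allE[where x = "\<lambda>_. 1"]) simp
  then show "gaussian_rv M (X t)" by simp
  show "expectation (X t) = 0"
    using assms by (simp add: fractional_brownian_motion_def)
  have "\<forall>s\<ge>0. \<forall>t\<ge>0. expectation (\<lambda>\<omega>. X s \<omega> * X t \<omega>) =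
      1/2 * (\<bar>t\<bar> powr (2 * H) + \<bar>s\<bar> powr (2 * H) - \<bar>t - s\<bar> powr (2 * H))"
    using assms(1) unfolding fractional_brownian_motion_def by blast
  \<comment> \<open>On the diagonal the subtracted term is \<open>0 powr (2 * H)\<close>, which is
    \<open>0\<close> by convention.\<close>
  from this[rule_format, OF assms(2) assms(2)]
  have "expectation (\<lambda>\<omega>. X t \<omega> * X t \<omega>) = t powr (2 * H)"
    using assms(2) by simp
  then show "expectation (\<lambda>\<omega>. X t \<omega> * X t \<omega>) = (t powr H)\<^sup>2"
    by (simp add: power2_eq_square flip: powr_add)
qed simp

text \<open>Almost surely \<open>X t\<close> equals its increment from time \<open>0\<close>. Time
  \<open>0\<close> is treated separately because the law of increments requires
  \<open>s < t\<close>.\<close>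

lemma distr_standard_brownian_motion:
  assumes "standard_brownian_motion M X" "0 \<le> t"
  shows "distr M borel (X t) = distr std_normal borel ((*) (sqrt t))"
proof (cases "t = 0")
  case True
  then show ?thesis
    using assms distr_AE_zero[of "X 0"] by (simp add: standard_brownian_motion_def)
next
  case False
  have X: "X s \<in> borel_measurable M" if "0 \<le> s" for s
    using assms(1) that by (simp add: standard_brownian_motion_def)
  have "distributed M lborel (\<lambda>\<omega>. X t \<omega> - X 0 \<omega>) (normal_density 0 (sqrt (t - 0)))"
    using assms False unfolding standard_brownian_motion_def
    by (elim conjE allE[where x = 0] allE[where x = t]) auto
  then have "distr M borel (\<lambda>\<omega>. X t \<omega> - X 0 \<omega>) = distr std_normal borel ((*) (sqrt t))"
    using distr_normal_density[of _ "sqrt t"] assms(2) False by simp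
  moreover have "distr M borel (\<lambda>\<omega>. X t \<omega> - X 0 \<omega>) = distr M borel (X t)"
  proof (rule distr_cong_AE)
    show "AE \<omega> in M. X t \<omega> - X 0 \<omega> = X t \<omega>"
      using assms(1) unfolding standard_brownian_motion_def by (auto elim: eventually_mono)
  qed (use X[OF assms(2)] X[of 0] in simp_all)
  ultimately show ?thesis by simp
qed

section \<open>Laws of iterated processes and of products\<close>

text \<open>Measurable functions of independent variables are independent. It will be used with
  \<open>f\<close> extracting the outermost path and \<open>h\<close> computing the inner iterated
  process.\<close>

lemma distr_pair_compose:
  assumes X: "X \<in> M \<rightarrow>\<^sub>M S" and Y: "Y \<in> M \<rightarrow>\<^sub>M T"
    and pair: "distr M S X \<Otimes>\<^sub>M distr M T Y = distr M (S \<Otimes>\<^sub>M T) (\<lambda>\<omega>. (X \<omega>, Y \<omega>))"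
    and f: "f \<in> S \<rightarrow>\<^sub>M S'" and h: "h \<in> T \<rightarrow>\<^sub>M T'"
  shows "distr M S' (\<lambda>\<omega>. f (X \<omega>)) \<Otimes>\<^sub>M distr M T' (\<lambda>\<omega>. h (Y \<omega>)) =
    distr M (S' \<Otimes>\<^sub>M T') (\<lambda>\<omega>. (f (X \<omega>), h (Y \<omega>)))"
proof -
  note [measurable] = X Y f h
  interpret D: prob_space "distr (distr M T Y) T' h"
    by (intro prob_space.prob_space_distr prob_space_distr) measurable
  have "distr M S' (\<lambda>\<omega>. f (X \<omega>)) \<Otimes>\<^sub>M distr M T' (\<lambda>\<omega>. h (Y \<omega>)) =
      distr (distr M S X) S' f \<Otimes>\<^sub>M distr (distr M T Y) T' h"
    by (simp add: distr_distr comp_def)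
  also have "\<dots> = distr (distr M S X \<Otimes>\<^sub>M distr M T Y) (S' \<Otimes>\<^sub>M T') (\<lambda>(x, y). (f x, h y))"
    by (rule pair_measure_distr) (measurable, rule D.sigma_finite_measure_axioms)
  also have "\<dots> = distr M (S' \<Otimes>\<^sub>M T') (\<lambda>\<omega>. (f (X \<omega>), h (Y \<omega>)))"
    unfolding pair by (simp add: distr_distr comp_def)
  finally show ?thesis .
qed

text \<open>Independence of the path of \<open>X\<close> and \<open>Y\<close> is expressed by the product law, as \<open>indep_var\<close>
  requires both variables to have the same range type.\<close>

lemma distr_process_at_indep_time:
  fixes X :: "real \<Rightarrow> 'a \<Rightarrow> real" and Y :: "'a \<Rightarrow> real"
  assumes X [measurable]: "(\<lambda>\<omega>. \<lambda>t\<in>{0..}. X t \<omega>) \<in> M \<rightarrow>\<^sub>M (\<Pi>\<^sub>M t\<in>{0::real..}. borel)"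
    and Y [measurable]: "Y \<in> borel_measurable M"
    and pair: "distr M (\<Pi>\<^sub>M t\<in>{0::real..}. borel) (\<lambda>\<omega>. \<lambda>t\<in>{0..}. X t \<omega>) \<Otimes>\<^sub>M distr M borel Y =
      distr M ((\<Pi>\<^sub>M t\<in>{0::real..}. borel) \<Otimes>\<^sub>M borel) (\<lambda>\<omega>. (\<lambda>t\<in>{0..}. X t \<omega>, Y \<omega>))"
    and cont: "\<And>\<omega>. \<omega> \<in> space M \<Longrightarrow> continuous_on {0..} (\<lambda>t. X t \<omega>)"
    and g: "g \<in> borel_measurable borel" "\<And>y. 0 \<le> g y"
    and law: "\<And>y. distr M borel (X (g y)) = distr std_normal borel ((*) y)"
  shows "(\<lambda>\<omega>. X (g (Y \<omega>)) \<omega>) \<in> borel_measurable M"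
    and "distr M borel (\<lambda>\<omega>. X (g (Y \<omega>)) \<omega>) =
      distr (std_normal \<Otimes>\<^sub>M distr M borel Y) borel (\<lambda>(z, y). z * y)"
proof -
  let ?P = "\<Pi>\<^sub>M t\<in>{0::real..}. (borel :: real measure)"
  let ?X = "\<lambda>\<omega>. \<lambda>t\<in>{0..}. X t \<omega>"
  let ?f = "\<lambda>(x, y). path_eval x (g y)"
  note g(1)[measurable]
  have "(\<lambda>p. (fst p, g (snd p))) \<in> ?P \<Otimes>\<^sub>M borel \<rightarrow>\<^sub>M ?P \<Otimes>\<^sub>M borel" by measurable
  from measurable_compose[OF this path_eval_measurable]
  have f [measurable]: "?f \<in> borel_measurable (?P \<Otimes>\<^sub>M borel)" by (simp add: split_beta)
  have eval: "path_eval (?X \<omega>) (g y) = X (g y) \<omega>" if "\<omega> \<in> space M" for \<omega> y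
    using cont[OF that] g(2)[of y] by (subst path_eval_eq) (simp_all only: continuous_on_restrict_iff, simp)
  from measurable_compose[OF measurable_Pair[OF X Y] f]
  show "(\<lambda>\<omega>. X (g (Y \<omega>)) \<omega>) \<in> borel_measurable M"
    by (rule measurable_cong[THEN iffD1, rotated]) (simp add: eval)
  interpret DX: prob_space "distr M ?P ?X" by (rule prob_space_distr) measurable
  interpret DY: prob_space "distr M borel Y" by (rule prob_space_distr) measurable
  interpret N: prob_space std_normal by (rule prob_space_std_normal)
  interpret PX: pair_sigma_finite "distr M ?P ?X" "distr M borel Y" ..
  interpret PN: pair_sigma_finite std_normal "distr M borel Y" ..
  \<comment> \<open>The random evaluation is a measurable functional of the path and
    \<open>Y\<close>, whose joint law is a product by independence.\<close>
  have "distr M borel (\<lambda>\<omega>. X (g (Y \<omega>)) \<omega>) = distr M borel (\<lambda>\<omega>. ?f (?X \<omega>, Y \<omega>))"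
    by (rule distr_cong) (simp_all add: eval)
  also have "\<dots> = distr (distr M ?P ?X \<Otimes>\<^sub>M distr M borel Y) borel ?f"
    unfolding pair by (subst distr_distr) (simp_all add: comp_def)
  \<comment> \<open>Both measures of \<open>A\<close> are integrals over the values \<open>y\<close>
    of \<open>Y\<close>. For fixed \<open>y\<close> the two sections have equal measure by
    \<open>law\<close>.\<close>
  also have "\<dots> = distr (std_normal \<Otimes>\<^sub>M distr M borel Y) borel (\<lambda>(z, y). z * y)"
  proof (rule measure_eqI)
    fix A assume "A \<in> sets (distr (distr M ?P ?X \<Otimes>\<^sub>M distr M borel Y) borel ?f)"
    then have A [measurable]: "A \<in> sets borel" by simp
    have fy: "(\<lambda>x. path_eval x (g y)) \<in> borel_measurable ?P" for y
    proof -
      have "(\<lambda>x. (x, y)) \<in> ?P \<rightarrow>\<^sub>M ?P \<Otimes>\<^sub>M borel" by simp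
      from measurable_compose[OF this f] show ?thesis by simp
    qed
    have *: "emeasure (distr M ?P ?X) ((\<lambda>x. (x, y)) -` (?f -` A \<inter> space (?P \<Otimes>\<^sub>M borel))) =
      emeasure std_normal ((\<lambda>z. (z, y)) -` ((\<lambda>(z, y). z * y) -` A))" for y
    proof -
      have "(\<lambda>x. (x, y)) -` (?f -` A \<inter> space (?P \<Otimes>\<^sub>M borel)) = (\<lambda>x. path_eval x (g y)) -` A \<inter> space ?P"
        by (auto simp: space_pair_measure)
      then have "emeasure (distr M ?P ?X) ((\<lambda>x. (x, y)) -` (?f -` A \<inter> space (?P \<Otimes>\<^sub>M borel))) =
          emeasure (distr (distr M ?P ?X) borel (\<lambda>x. path_eval x (g y))) A"
        using fy[of y] by (subst (2) emeasure_distr) simp_all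
      also have "distr (distr M ?P ?X) borel (\<lambda>x. path_eval x (g y)) = distr M borel (X (g y))"
        using fy[of y] by (subst distr_distr) (auto simp: eval intro!: distr_cong)
      also have "\<dots> = distr std_normal borel ((*) y)" by (rule law)
      also have "emeasure \<dots> A = emeasure std_normal ((*) y -` A)"
        by (subst emeasure_distr) simp_all
      also have "(*) y -` A = (\<lambda>z. (z, y)) -` ((\<lambda>(z, y). z * y) -` A)"
        by (auto simp: mult.commute)
      finally show ?thesis .
    qed
    have mult: "(\<lambda>(z, y). z * y :: real) \<in> borel_measurable (std_normal \<Otimes>\<^sub>M distr M borel Y)"
      by measurable
    have "emeasure (distr (distr M ?P ?X \<Otimes>\<^sub>M distr M borel Y) borel ?f) A =
        emeasure (distr M ?P ?X \<Otimes>\<^sub>M distr M borel Y) (?f -` A \<inter> space (?P \<Otimes>\<^sub>M borel))"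
      by (subst emeasure_distr) (simp_all add: space_pair_measure)
    also have "\<dots> = (\<integral>\<^sup>+y. emeasure (distr M ?P ?X)
        ((\<lambda>x. (x, y)) -` (?f -` A \<inter> space (?P \<Otimes>\<^sub>M borel))) \<partial>distr M borel Y)"
    proof (rule PX.emeasure_pair_measure_alt2)
      have "?f -` A \<inter> space (?P \<Otimes>\<^sub>M borel) \<in> sets (?P \<Otimes>\<^sub>M borel)"
        using f A by (rule measurable_sets)
      then show "?f -` A \<inter> space (?P \<Otimes>\<^sub>M borel) \<in> sets (distr M ?P ?X \<Otimes>\<^sub>M distr M borel Y)"
        by (simp cong: sets_pair_measure_cong)
    qed
    also have "\<dots> = (\<integral>\<^sup>+y. emeasure std_normal
        ((\<lambda>z. (z, y)) -` ((\<lambda>(z, y). z * y) -` A)) \<partial>distr M borel Y)"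
      unfolding * ..
    also have "\<dots> = emeasure (std_normal \<Otimes>\<^sub>M distr M borel Y) ((\<lambda>(z, y). z * y) -` A)"
      using measurable_sets[OF mult A]
      by (intro PN.emeasure_pair_measure_alt2[symmetric]) (simp add: space_pair_measure)
    also have "\<dots> = emeasure (distr (std_normal \<Otimes>\<^sub>M distr M borel Y) borel (\<lambda>(z, y). z * y)) A"
      using mult by (subst emeasure_distr) (simp_all add: space_pair_measure)
    finally show "emeasure (distr (distr M ?P ?X \<Otimes>\<^sub>M distr M borel Y) borel ?f) A =
        emeasure (distr (std_normal \<Otimes>\<^sub>M distr M borel Y) borel (\<lambda>(z, y). z * y)) A" .
  qed simp
  finally show "distr M borel (\<lambda>\<omega>. X (g (Y \<omega>)) \<omega>) =
      distr (std_normal \<Otimes>\<^sub>M distr M borel Y) borel (\<lambda>(z, y). z * y)" .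
qed

text \<open>The offset \<open>k\<close> lets the induction peel off the outermost process.\<close>

lemma distr_iterated_process_offset:
  fixes B :: "nat \<Rightarrow> real \<Rightarrow> 'a \<Rightarrow> real"
  assumes indep: "indep_processes M I B"
    and cont: "\<And>i \<omega>. i \<in> I \<Longrightarrow> \<omega> \<in> space M \<Longrightarrow> continuous_on {0..} (\<lambda>t. B i t \<omega>)"
    and g: "g \<in> borel_measurable borel" "\<And>y. 0 \<le> g y"
    and "{Suc k..Suc (k + m)} \<subseteq> I" "0 \<le> t"
    and outer: "\<And>i y. i \<in> {Suc k..<Suc (k + m)} \<Longrightarrow>
      distr M borel (B i (g y)) = distr std_normal borel ((*) y)"
    and inner: "distr M borel (B (Suc (k + m)) t) = distr std_normal borel ((*) c)"
  shows "iterated_process g (\<lambda>i. B (k + i)) m t \<in> borel_measurable M \<and>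
    distr M borel (iterated_process g (\<lambda>i. B (k + i)) m t) = distr (normal_product m) borel ((*) c)"
  using assms(5-)
proof (induction m arbitrary: k)
  case 0
  have "(\<lambda>\<omega>. \<lambda>t\<in>{0..}. B (Suc k) t \<omega>) \<in> M \<rightarrow>\<^sub>M (\<Pi>\<^sub>M t\<in>{0::real..}. borel)"
    using indep 0(1) unfolding indep_processes_def indep_vars_def by auto
  from measurable_compose[OF this measurable_component_singleton[of t]] 0(2)
  have "B (Suc k) t \<in> borel_measurable M" by simp
  with 0(4) show ?case by (simp add: fun_eq_iff cong: distr_cong)
next
  case (Suc m)
  let ?P = "\<Pi>\<^sub>M t\<in>{0::real..}. (borel :: real measure)"
  let ?path = "\<lambda>i \<omega>. \<lambda>t\<in>{0..}. B i t \<omega>"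
  let ?J = "{Suc (Suc k)..Suc (Suc (k + m))}"
  \<comment> \<open>The inner iterated process as a functional of the paths indexed by
    \<open>?J\<close>; the shift \<open>Suc k + i\<close> matches the numbering of the processes
    from 1.\<close>
  let ?G = "\<lambda>x. iterated_process g (\<lambda>i s x. path_eval (x (Suc k + i)) s) m t x"
  define Y where "Y = iterated_process g (\<lambda>i. B (Suc k + i)) m t"
  have IH: "Y \<in> borel_measurable M" "distr M borel Y = distr (normal_product m) borel ((*) c)"
  proof -
    have "Y \<in> borel_measurable M \<and> distr M borel Y = distr (normal_product m) borel ((*) c)"
      unfolding Y_def
    proof (rule Suc.IH)
      show "distr M borel (B i (g y)) = distr std_normal borel ((*) y)"
        if "i \<in> {Suc (Suc k)..<Suc (Suc k + m)}" for i y
        using that by (intro Suc.prems(3)) auto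
    qed (use Suc.prems(1,2,4) in auto)
    then show "Y \<in> borel_measurable M" "distr M borel Y = distr (normal_product m) borel ((*) c)"
      by blast+
  qed
  have "(\<lambda>(x, s). path_eval (x (Suc k + i)) s) \<in> borel_measurable ((\<Pi>\<^sub>M i\<in>?J. ?P) \<Otimes>\<^sub>M borel)"
    if "i \<in> {1..Suc m}" for i
  proof -
    have "(\<lambda>x. x (Suc k + i)) \<in> (\<Pi>\<^sub>M i\<in>?J. ?P) \<rightarrow>\<^sub>M ?P"
      using that by (intro measurable_component_singleton) auto
    then have "(\<lambda>p. (fst p (Suc k + i), snd p)) \<in> (\<Pi>\<^sub>M i\<in>?J. ?P) \<Otimes>\<^sub>M borel \<rightarrow>\<^sub>M ?P \<Otimes>\<^sub>M borel"
      by (intro measurable_Pair measurable_compose[OF measurable_fst]) auto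
    from measurable_compose[OF this path_eval_measurable] show ?thesis
      by (simp add: split_beta)
  qed
  then have G: "?G \<in> borel_measurable (\<Pi>\<^sub>M i\<in>?J. ?P)"
    by (rule iterated_process_measurable[OF _ g(1) measurable_const]) auto
  \<comment> \<open>Splitting the indices into \<open>{Suc k}\<close> and \<open>?J\<close> makes
    the outermost path independent of all inner paths jointly.\<close>
  have "indep_var (\<Pi>\<^sub>M i\<in>{Suc k}. ?P) (\<lambda>\<omega>. \<lambda>i\<in>{Suc k}. ?path i \<omega>)
      (\<Pi>\<^sub>M i\<in>?J. ?P) (\<lambda>\<omega>. \<lambda>i\<in>?J. ?path i \<omega>)"
    using indep Suc.prems(1) unfolding indep_processes_def by (intro indep_var_restrict) auto
  then have m: "(\<lambda>\<omega>. \<lambda>i\<in>{Suc k}. ?path i \<omega>) \<in> M \<rightarrow>\<^sub>M (\<Pi>\<^sub>M i\<in>{Suc k}. ?P)"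
      "(\<lambda>\<omega>. \<lambda>i\<in>?J. ?path i \<omega>) \<in> M \<rightarrow>\<^sub>M (\<Pi>\<^sub>M i\<in>?J. ?P)"
    and pair: "distr M (\<Pi>\<^sub>M i\<in>{Suc k}. ?P) (\<lambda>\<omega>. \<lambda>i\<in>{Suc k}. ?path i \<omega>) \<Otimes>\<^sub>M
        distr M (\<Pi>\<^sub>M i\<in>?J. ?P) (\<lambda>\<omega>. \<lambda>i\<in>?J. ?path i \<omega>) =
      distr M ((\<Pi>\<^sub>M i\<in>{Suc k}. ?P) \<Otimes>\<^sub>M (\<Pi>\<^sub>M i\<in>?J. ?P))
        (\<lambda>\<omega>. (\<lambda>i\<in>{Suc k}. ?path i \<omega>, \<lambda>i\<in>?J. ?path i \<omega>))"
    unfolding indep_var_distribution_eq by blast+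
  have proj: "(\<lambda>x. x (Suc k)) \<in> (\<Pi>\<^sub>M i\<in>{Suc k}. ?P) \<rightarrow>\<^sub>M ?P"
    by (rule measurable_component_singleton) simp
  have path: "?path (Suc k) \<in> M \<rightarrow>\<^sub>M ?P"
    using measurable_compose[OF m(1) proj] by simp
  have ind: "distr M ?P (?path (Suc k)) \<Otimes>\<^sub>M distr M borel (\<lambda>\<omega>. ?G (\<lambda>i\<in>?J. ?path i \<omega>)) =
      distr M (?P \<Otimes>\<^sub>M borel) (\<lambda>\<omega>. (?path (Suc k) \<omega>, ?G (\<lambda>i\<in>?J. ?path i \<omega>)))"
    using distr_pair_compose[OF m pair proj G] by simp
  have G_eq: "?G (\<lambda>i\<in>?J. ?path i \<omega>) = Y \<omega>" if "\<omega> \<in> space M" for \<omega>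
  proof -
    have "?G (\<lambda>i\<in>?J. ?path i \<omega>) =
      iterated_process g (\<lambda>i s x. path_eval (x i) s) m t (\<lambda>i. (\<lambda>i\<in>?J. ?path i \<omega>) (Suc k + i))"
    proof -
      \<comment> \<open>Reindexing commutes with iteration, so the offset moves from the processes
        to the family of paths.\<close>
      have "iterated_process g (\<lambda>i s x. path_eval (x (h i)) s) m s x =
          iterated_process g (\<lambda>i s x. path_eval (x i) s) m s (\<lambda>i. x (h i))"
        for h :: "nat \<Rightarrow> nat" and s x
        by (induction m arbitrary: s) simp_all
      from this[of "\<lambda>i. Suc k + i"] show ?thesis .
    qed
    also have "\<dots> = Y \<omega>"
      unfolding Y_def using Suc.prems(1,2) that
      by (intro iterated_process_path_eval g(2) cont) auto
    finally show ?thesis .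
  qed
  have "distr M ?P (?path (Suc k)) \<Otimes>\<^sub>M distr M borel Y =
      distr M (?P \<Otimes>\<^sub>M borel) (\<lambda>\<omega>. (?path (Suc k) \<omega>, Y \<omega>))"
  proof -
    have "distr M borel (\<lambda>\<omega>. ?G (\<lambda>i\<in>?J. ?path i \<omega>)) = distr M borel Y"
      by (rule distr_cong) (simp_all only: G_eq)
    moreover have "distr M (?P \<Otimes>\<^sub>M borel) (\<lambda>\<omega>. (?path (Suc k) \<omega>, ?G (\<lambda>i\<in>?J. ?path i \<omega>))) =
        distr M (?P \<Otimes>\<^sub>M borel) (\<lambda>\<omega>. (?path (Suc k) \<omega>, Y \<omega>))"
      by (rule distr_cong) (simp_all only: G_eq)
    ultimately show ?thesis using ind by (simp only:)
  qed
  note * = distr_process_at_indep_time[OF path IH(1) this cont g]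
  have eq: "iterated_process g (\<lambda>i. B (k + i)) (Suc m) t = (\<lambda>\<omega>. B (Suc k) (g (Y \<omega>)) \<omega>)"
    unfolding Y_def by (rule ext, subst iterated_process_shift) simp
  have I: "Suc k \<in> I" and law: "distr M borel (B (Suc k) (g y)) = distr std_normal borel ((*) y)" for y
    using Suc.prems(1,3) by auto
  have "distr M borel (\<lambda>\<omega>. B (Suc k) (g (Y \<omega>)) \<omega>) =
      distr (std_normal \<Otimes>\<^sub>M distr M borel Y) borel (\<lambda>(z, y). z * y)"
    by (rule *(2)[OF I _ law])
  also have "\<dots> = distr (normal_product (Suc m)) borel ((*) c)"
  proof -
    \<comment> \<open>The new factor carries scaling \<open>1\<close>, so only the constant
      \<open>c\<close> of the innermost process survives.\<close>
    have "distr std_normal borel ((*) 1) = std_normal"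
      by (rule trans[OF distr_cong distr_id2]) simp_all
    then show ?thesis
      using distr_times_scaled_normal_product[of 1 m c] IH(2) by (simp only: mult_1_left)
  qed
  finally show ?case
    unfolding eq using *(1)[OF I _ law] by blast
qed

text \<open>Separate conditions on the outer processes and on the innermost one let the same result
  treat a fractional motion placed inside Brownian motions.\<close>

lemma distr_iterated_process:
  fixes B :: "nat \<Rightarrow> real \<Rightarrow> 'a \<Rightarrow> real"
  assumes "1 \<le> n" "indep_processes M {1..n} B"
    and "\<And>i \<omega>. i \<in> {1..n} \<Longrightarrow> \<omega> \<in> space M \<Longrightarrow> continuous_on {0..} (\<lambda>t. B i t \<omega>)"
    and "g \<in> borel_measurable borel" "\<And>y. 0 \<le> g y" "0 \<le> t"
    and "\<And>i y. i \<in> {1..<n} \<Longrightarrow> distr M borel (B i (g y)) = distr std_normal borel ((*) y)"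
    and "distr M borel (B n t) = distr std_normal borel ((*) c)"
  shows "iterated_process g B (n - 1) t \<in> borel_measurable M"
    and "distr M borel (iterated_process g B (n - 1) t) = distr (normal_product (n - 1)) borel ((*) c)"
proof -
  have "iterated_process g (\<lambda>i. B (0 + i)) (n - 1) t \<in> borel_measurable M \<and>
      distr M borel (iterated_process g (\<lambda>i. B (0 + i)) (n - 1) t) =
        distr (normal_product (n - 1)) borel ((*) c)"
  proof (rule distr_iterated_process_offset[OF assms(2-5) _ assms(6)])
    show "distr M borel (B i (g y)) = distr std_normal borel ((*) y)"
      if "i \<in> {Suc 0..<Suc (0 + (n - 1))}" for i y
      using that assms(1) by (intro assms(7)) auto
    show "distr M borel (B (Suc (0 + (n - 1))) t) = distr std_normal borel ((*) c)"
      using assms(1,8) by simp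
  qed (use assms(1) in auto)
  then show "iterated_process g B (n - 1) t \<in> borel_measurable M"
    and "distr M borel (iterated_process g B (n - 1) t) = distr (normal_product (n - 1)) borel ((*) c)"
    by simp_all
qed

text \<open>The last variable is independent of the product of the earlier ones; putting it on the
  left matches the recursion of \<open>normal_product\<close>.\<close>

lemma distr_prod_scaled_std_normal:
  fixes X :: "nat \<Rightarrow> 'a \<Rightarrow> real"
  assumes indep: "indep_vars (\<lambda>_. borel) X {1..Suc m}"
    and law: "\<And>i. i \<in> {1..Suc m} \<Longrightarrow> distr M borel (X i) = distr std_normal borel ((*) a)"
  shows "distr M borel (\<lambda>\<omega>. \<Prod>i\<in>{1..Suc m}. X i \<omega>) = distr (normal_product m) borel ((*) (a ^ Suc m))"
  using assms
proof (induction m)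
  case 0
  then show ?case by simp
next
  case (Suc m)
  let ?Y = "\<lambda>\<omega>. \<Prod>i\<in>{1..Suc m}. X i \<omega>"
  let ?Z = "X (Suc (Suc m))"
  have IH: "distr M borel ?Y = distr (normal_product m) borel ((*) (a ^ Suc m))"
    using Suc.prems by (intro Suc.IH indep_vars_subset[OF Suc.prems(1)]) auto
  have "indep_var borel ?Z borel ?Y"
    by (intro indep_vars_prod indep_vars_subset[OF Suc.prems(1)]) auto
  then have m: "?Z \<in> borel_measurable M" "?Y \<in> borel_measurable M"
    and pair: "distr M borel ?Z \<Otimes>\<^sub>M distr M borel ?Y = distr M (borel \<Otimes>\<^sub>M borel) (\<lambda>\<omega>. (?Z \<omega>, ?Y \<omega>))"
    unfolding indep_var_distribution_eq by auto
  have "distr M borel (\<lambda>\<omega>. \<Prod>i\<in>{1..Suc (Suc m)}. X i \<omega>) = distr M borel (\<lambda>\<omega>. ?Z \<omega> * ?Y \<omega>)"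
    by (simp add: mult.commute)
  also have "\<dots> = distr (distr M borel ?Z \<Otimes>\<^sub>M distr M borel ?Y) borel (\<lambda>(z, y). z * y)"
    unfolding pair using m by (subst distr_distr) (simp_all add: comp_def)
  also have "\<dots> = distr (normal_product (Suc m)) borel ((*) (a * a ^ Suc m))"
    using IH Suc.prems(2)[of "Suc (Suc m)"] distr_times_scaled_normal_product[of a m "a ^ Suc m"] by simp
  finally show ?case by simp
qed

text \<open>Evaluation at a fixed time is a coordinate projection of the path, hence measurable, and
  so preserves independence.\<close>

lemma indep_processes_at:
  assumes "indep_processes M I B" "0 \<le> t"
  shows "indep_vars (\<lambda>_. borel) (\<lambda>i. B i t) I"
proof -
  have "indep_vars (\<lambda>_. borel) (\<lambda>i \<omega>. (\<lambda>t\<in>{0..}. B i t \<omega>) t) I"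
    using assms unfolding indep_processes_def
    by (elim indep_vars_compose2[where Y = "\<lambda>_ x. x t"]) (simp add: measurable_component_singleton)
  then show ?thesis using assms(2) by simp
qed

end

section \<open>Comparison of the three laws\<close>

theorem theorem3p3:
  fixes H :: real and n :: nat
    and M :: "'a measure" and B :: "nat \<Rightarrow> real \<Rightarrow> 'a \<Rightarrow> real"
    and N :: "'b measure" and W :: "nat \<Rightarrow> real \<Rightarrow> 'b \<Rightarrow> real"
    and P :: "'c measure" and C :: "nat \<Rightarrow> real \<Rightarrow> 'c \<Rightarrow> real"
  assumes "0 < H" "H < 1" "1 \<le> n"
    and "prob_space M"
    and "\<And>i. i \<in> {1..n} \<Longrightarrow> fractional_brownian_motion M H (B i)"
    and "indep_processes M {1..n} B"
    and "prob_space N"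
    and "\<And>i. i \<in> {1..<n} \<Longrightarrow> standard_brownian_motion N (W i)"
    and "fractional_brownian_motion N H (W n)"
    and "indep_processes N {1..n} W"
    and "prob_space P"
    and "\<And>i. i \<in> {1..n} \<Longrightarrow> fractional_brownian_motion P (H / real n) (C i)"
    and "indep_processes P {1..n} C"
  shows "\<forall>t>0.
     same_law M (iterated_process (\<lambda>x. \<bar>x\<bar> powr (1 / H)) B (n - 1) t)
              N (iterated_process (\<lambda>x. \<bar>x\<bar>\<^sup>2) W (n - 1) t) \<and>
     same_law N (iterated_process (\<lambda>x. \<bar>x\<bar>\<^sup>2) W (n - 1) t)
              P (\<lambda>\<omega>. \<Prod>i\<in>{1..n}. C i t \<omega>)"
proof (intro allI impI)
  fix t :: real assume t: "0 < t"
  interpret M: prob_space M by fact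
  interpret N: prob_space N by fact
  interpret P: prob_space P by fact
  \<comment> \<open>The common law to which all three expressions are reduced.\<close>
  let ?L = "distr (normal_product (n - 1)) borel ((*) (t powr H))"
  have contB: "continuous_on {0..} (\<lambda>t. B i t \<omega>)" if "i \<in> {1..n}" "\<omega> \<in> space M" for i \<omega>
    using assms(5)[OF that(1)] that(2) by (simp add: fractional_brownian_motion_def)
  have lawB: "distr M borel (B i (\<bar>y\<bar> powr (1 / H))) = distr std_normal borel ((*) y)"
    if "i \<in> {1..<n}" for i y
  proof -
    \<comment> \<open>The exponents \<open>1 / H\<close> and \<open>H\<close> cancel, leaving the
      scale \<open>\<bar>y\<bar>\<close>.\<close>
    have "distr M borel (B i (\<bar>y\<bar> powr (1 / H))) = distr std_normal borel ((*) \<bar>y\<bar>)"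
      using M.distr_fractional_brownian_motion[OF assms(5)[of i], of "\<bar>y\<bar> powr (1 / H)"] that \<open>0 < H\<close>
      by (simp add: powr_powr)
    then show ?thesis by (simp add: distr_std_normal_abs)
  qed
  have J: "iterated_process (\<lambda>x. \<bar>x\<bar> powr (1 / H)) B (n - 1) t \<in> borel_measurable M"
    "distr M borel (iterated_process (\<lambda>x. \<bar>x\<bar> powr (1 / H)) B (n - 1) t) = ?L"
    using M.distr_iterated_process[OF \<open>1 \<le> n\<close> assms(6) contB _ _ _ lawB
        M.distr_fractional_brownian_motion[OF assms(5)]] t \<open>1 \<le> n\<close>
    by simp_all
  have contW: "continuous_on {0..} (\<lambda>t. W i t \<omega>)" if "i \<in> {1..n}" "\<omega> \<in> space N" for i \<omega>
    using assms(8)[of i] assms(9) that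
    by (cases "i = n") (auto simp: fractional_brownian_motion_def standard_brownian_motion_def)
  \<comment> \<open>The standard deviation at time \<open>\<bar>y\<bar>\<^sup>2\<close> is
    \<open>\<bar>y\<bar>\<close>, and symmetry removes the absolute value.\<close>
  have lawW: "distr N borel (W i (\<bar>y\<bar>\<^sup>2)) = distr std_normal borel ((*) y)"
    if "i \<in> {1..<n}" for i y
    using N.distr_standard_brownian_motion[OF assms(8)[OF that], of "\<bar>y\<bar>\<^sup>2"]
    by (simp add: distr_std_normal_abs)
  have K: "iterated_process (\<lambda>x. \<bar>x\<bar>\<^sup>2) W (n - 1) t \<in> borel_measurable N"
    "distr N borel (iterated_process (\<lambda>x. \<bar>x\<bar>\<^sup>2) W (n - 1) t) = ?L"
    using N.distr_iterated_process[OF \<open>1 \<le> n\<close> assms(10) contW _ _ _ lawW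
        N.distr_fractional_brownian_motion[OF assms(9)]] t
    by simp_all
  have indepC: "P.indep_vars (\<lambda>_. borel) (\<lambda>i. C i t) {1..n}"
    using t by (intro P.indep_processes_at assms(13)) simp
  then have "C i t \<in> borel_measurable P" if "i \<in> {1..n}" for i
    using that by (auto simp: P.indep_vars_def)
  then have Cm: "(\<lambda>\<omega>. \<Prod>i\<in>{1..n}. C i t \<omega>) \<in> borel_measurable P"
    by (intro borel_measurable_prod)
  have "distr P borel (C i t) = distr std_normal borel ((*) (t powr (H / real n)))"
    if "i \<in> {1..n}" for i
    using t by (intro P.distr_fractional_brownian_motion assms(12) that) simp
  with P.distr_prod_scaled_std_normal[of "\<lambda>i. C i t" "n - 1" "t powr (H / real n)"] indepC \<open>1 \<le> n\<close>
  have "distr P borel (\<lambda>\<omega>. \<Prod>i\<in>{1..n}. C i t \<omega>) =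
      distr (normal_product (n - 1)) borel ((*) ((t powr (H / real n)) ^ n))"
    by simp
  \<comment> \<open>The \<open>n\<close> exponents \<open>H / n\<close> add up to \<open>H\<close>;
    this is why the product needs the smaller Hurst parameter.\<close>
  also have "(t powr (H / real n)) ^ n = t powr H"
    using t \<open>1 \<le> n\<close> by (simp add: powr_powr flip: powr_realpow)
  finally show "same_law M (iterated_process (\<lambda>x. \<bar>x\<bar> powr (1 / H)) B (n - 1) t)
              N (iterated_process (\<lambda>x. \<bar>x\<bar>\<^sup>2) W (n - 1) t) \<and>
     same_law N (iterated_process (\<lambda>x. \<bar>x\<bar>\<^sup>2) W (n - 1) t)
              P (\<lambda>\<omega>. \<Prod>i\<in>{1..n}. C i t \<omega>)"
    using J K Cm by (simp add: same_law_def)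
qed

end
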